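(* For a tight twisted product $T=M\times_\Phi^qS$, we have $$\operatorname{Reg}(T)=\{(i,a)\in\operatorname{Reg}(M)\times\operatorname{Reg}(S): i\leq_{\mathscr J}^M\Phi(D_a^S)q\}.$$
   Context: $S$ is a monoid (multiplicative, identity $1$); $M$ is a commutative monoid (additive, identity $0$); $q\in M$ is fixed; $\mathbb N=\{0,1,2,\dots\}$. A twisting of $S$ is a map $\Phi:S\times S\to\mathbb N$ with $\Phi(a,b)+\Phi(ab,c)=\Phi(a,bc)+\Phi(b,c)$ for all $a,b,c\in S$. It is tight if (a) for all $a,b\in S$ there is $a'\in S$ with $ab=a'b$ and $\Phi(a',b)=0$; and (b) for all $a,b\in S$ there is $b'\in S$ with $ab=ab'$ and $\Phi(a,b')=0$. The twisted product $M\times_\Phi^qS$ is the semigroup with underlying set $M\times S$ and product $(i,a)(j,b)=(i+j+\Phi(a,b)q,\,ab)$, where for $n\in\mathbb N$, $nq$ is the $n$-fold sum of $q$ in $M$ (and $0q=0$); it is called tight if $\Phi$ is tight (in which case it is a monoid with identity $(0,1)$). An element $a$ of a semigroup $X$ is regular if $a\in aXa$; $\operatorname{Reg}(X)$ is the set of regular elements of $X$. In $M$, $i\leq_{\mathscr J}^Mj$ means $i=j+l$ for some $l\in M$. $D_a^S$ is the $\mathscr D$-class of $a$ in $S$, where $\mathscr D=\mathscr L\vee\mathscr R$ with $a\,\mathscr L\,b\iff Sa=Sb$ and $a\,\mathscr R\,b\iff aS=bS$. For a regular $\mathscr D$-class $D$ of $S$ (one all of whose elements are regular; equivalently one containing a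 regular element), $\Phi(D)=\min\{\Phi(e,e):e\in D,\ e^2=e\}$. *)

theory Defs
  imports Main
begin

definition twisting :: "('s::monoid_mult \<Rightarrow> 's \<Rightarrow> nat) \<Rightarrow> bool" where
  "twisting \<Phi> \<longleftrightarrow> (\<forall>a b c. \<Phi> a b + \<Phi> (a * b) c = \<Phi> a (b * c) + \<Phi> b c)"

definition tight :: "('s::monoid_mult \<Rightarrow> 's \<Rightarrow> nat) \<Rightarrow> bool" where
  "tight \<Phi> \<longleftrightarrow>
     (\<forall>a b. \<exists>a'. a * b = a' * b \<and> \<Phi> a' b = 0) \<and>
     (\<forall>a b. \<exists>b'. a * b = a * b' \<and> \<Phi> a b' = 0)"

definition nfold :: "nat \<Rightarrow> 'm::comm_monoid_add \<Rightarrow> 'm" where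
  "nfold n q = (\<Sum>k<n. q)"

definition twisted_mult ::
  "('s::monoid_mult \<Rightarrow> 's \<Rightarrow> nat) \<Rightarrow> 'm::comm_monoid_add \<Rightarrow> 'm \<times> 's \<Rightarrow> 'm \<times> 's \<Rightarrow> 'm \<times> 's" where
  "twisted_mult \<Phi> q = (\<lambda>(i, a) (j, b). (i + j + nfold (\<Phi> a b) q, a * b))"

text \<open>
  The set of regular elements is taken with respect to an explicit binary operation, so that it
  applies uniformly to the additive monoid \<open>M\<close>, the multiplicative monoid \<open>S\<close>, and the twisted
  product, whose operation depends on \<open>\<Phi>\<close> and \<open>q\<close>.
\<close>

definition Reg :: "('x \<Rightarrow> 'x \<Rightarrow> 'x) \<Rightarrow> 'x set" where
  "Reg f = {a. a \<in> {f (f a x) a | x. True}}"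

definition leJ :: "'m::comm_monoid_add \<Rightarrow> 'm \<Rightarrow> bool" where
  "leJ i j \<longleftrightarrow> (\<exists>l. i = j + l)"

definition green_L :: "('s::monoid_mult) rel" where
  "green_L = {(a, b). {s * a | s. True} = {s * b | s. True}}"

definition green_R :: "('s::monoid_mult) rel" where
  "green_R = {(a, b). {a * s | s. True} = {b * s | s. True}}"

text \<open>The join in the lattice of equivalence relations: the least equivalence containing both.\<close>

definition green_D :: "('s::monoid_mult) rel" where
  "green_D = \<Inter> {E. equiv UNIV E \<and> green_L \<subseteq> E \<and> green_R \<subseteq> E}"

definition D_class :: "'s::monoid_mult \<Rightarrow> 's set" where
  "D_class a = green_D `` {a}"

text \<open>
  Only meaningful when \<open>D\<close> contains an idempotent, as every regular \<open>\<D>\<close>-class does. The set may be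
  infinite, hence the least element is taken rather than \<open>Min\<close>.
\<close>

definition twist_of_class :: "('s::monoid_mult \<Rightarrow> 's \<Rightarrow> nat) \<Rightarrow> 's set \<Rightarrow> nat" where
  "twist_of_class \<Phi> D = (LEAST n. n \<in> {\<Phi> e e | e. e \<in> D \<and> e * e = e})"

lemma nfold_add: "nfold (m + n) q = nfold m q + nfold n q"
  by (induction n) (simp_all add: nfold_def add.assoc)

lemma semigroup_twisted_mult:
  fixes q :: "'m::comm_monoid_add" and \<Phi> :: "'s::monoid_mult \<Rightarrow> 's \<Rightarrow> nat"
  assumes "twisting \<Phi>"
  shows "semigroup (twisted_mult \<Phi> q)"
proof
  fix x y z :: "'m \<times> 's"
  obtain i a j b k c where [simp]: "x = (i, a)" "y = (j, b)" "z = (k, c)"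
    by (metis surj_pair)
  have "nfold (\<Phi> a b) q + nfold (\<Phi> (a * b) c) q = nfold (\<Phi> a (b * c)) q + nfold (\<Phi> b c) q"
    using assms unfolding twisting_def nfold_add[symmetric] by metis
  then show "twisted_mult \<Phi> q (twisted_mult \<Phi> q x y) z = twisted_mult \<Phi> q x (twisted_mult \<Phi> q y z)"
    by (simp add: twisted_mult_def ac_simps)
qed

end

theory Submission
  imports Defs
begin

text \<open>
  If \<open>a = a b a\<close>, the cocycle identity gives \<open>\<Phi> (a b) a = \<Phi> e e\<close> for the idempotent \<open>e = a b\<close>
  of \<open>D\<^sub>a\<close>, so the exponent \<open>\<Phi> a b + \<Phi> (a b) a\<close> of \<open>q\<close> picked up in \<open>(i, a) (j, b) (i, a)\<close> is at
  least \<open>\<Phi> (D\<^sub>a)\<close>. Conversely, given an idempotent \<open>e\<close> of \<open>D\<^sub>a\<close>, choose \<open>c\<close> with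
  \<open>a \<R> c \<L> e\<close>. Tightness lets all the multipliers witnessing these relations be chosen with
  vanishing twist, and composing them produces \<open>b\<close> with \<open>a = a b a\<close> whose exponent is at most
  \<open>\<Phi> e e\<close>; the difference is absorbed by the \<open>M\<close>-component of the pre-inverse.
\<close>

text \<open>Since \<open>1\<close> puts each element into its own principal left ideal, equality of
  these ideals amounts to mutual divisibility; the divisors are the multipliers on which tightness
  acts.\<close>

lemma green_L_iff: "(a, b) \<in> green_L \<longleftrightarrow> (\<exists>s. a = s * b) \<and> (\<exists>t. b = t * a)"
proof
  assume "(a, b) \<in> green_L"
  then have "{s * a | s. True} = {s * b | s. True}" by (simp add: green_L_def)
  moreover have "a \<in> {s * a | s. True}" "b \<in> {s * b | s. True}"
    by (auto intro: exI[of _ 1])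
  ultimately show "(\<exists>s. a = s * b) \<and> (\<exists>t. b = t * a)" by blast
next
  assume "(\<exists>s. a = s * b) \<and> (\<exists>t. b = t * a)"
  then obtain s t where s: "a = s * b" and t: "b = t * a" by blast
  have "x * a = (x * s) * b" "x * b = (x * t) * a" for x
    using arg_cong[OF s, of "(*) x"] arg_cong[OF t, of "(*) x"] by (simp_all only: mult.assoc)
  then have "{s * a | s. True} = {s * b | s. True}" by blast
  then show "(a, b) \<in> green_L" by (simp add: green_L_def)
qed

lemma green_R_iff: "(a, b) \<in> green_R \<longleftrightarrow> (\<exists>s. a = b * s) \<and> (\<exists>t. b = a * t)"
proof
  assume "(a, b) \<in> green_R"
  then have "{a * s | s. True} = {b * s | s. True}" by (simp add: green_R_def)
  moreover have "a \<in> {a * s | s. True}" "b \<in> {b * s | s. True}"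
    by (auto intro: exI[of _ 1])
  ultimately show "(\<exists>s. a = b * s) \<and> (\<exists>t. b = a * t)" by blast
next
  assume "(\<exists>s. a = b * s) \<and> (\<exists>t. b = a * t)"
  then obtain s t where s: "a = b * s" and t: "b = a * t" by blast
  have "a * x = b * (s * x)" "b * x = a * (t * x)" for x
    using arg_cong[OF s, of "\<lambda>y. y * x"] arg_cong[OF t, of "\<lambda>y. y * x"]
    by (simp_all only: mult.assoc)
  then have "{a * s | s. True} = {b * s | s. True}" by blast
  then show "(a, b) \<in> green_R" by (simp add: green_R_def)
qed

lemma equiv_green_L: "equiv UNIV green_L"
  by (auto simp: equiv_def refl_on_def sym_def trans_def green_L_def)

lemma equiv_green_R: "equiv UNIV green_R"
  by (auto simp: equiv_def refl_on_def sym_def trans_def green_R_def)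

text \<open>The element \<open>a * v\<close> completes the square: \<open>t\<close> carries the
  relation \<open>c = c * v * w\<close> over to \<open>a = a * v * w\<close>, and left
  multiplication by \<open>s\<close> and \<open>t\<close> moves between \<open>a * v\<close> and
  \<open>b\<close>.\<close>

lemma green_L_O_green_R_subset: "green_L O green_R \<subseteq> green_R O green_L"
proof clarify
  fix a b c :: "'a::monoid_mult"
  assume "(a, c) \<in> green_L" "(c, b) \<in> green_R"
  then obtain s t v w where eqs: "c = s * a" "a = t * c" "b = c * v" "c = b * w"
    unfolding green_L_iff green_R_iff by blast
  have "a * v = t * b" using eqs(2,3) by (simp add: mult.assoc)
  moreover have "b = s * (a * v)" using eqs(1,3) by (simp add: mult.assoc)
  moreover have "a = (a * v) * w" using eqs(2-4) by (metis mult.assoc)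
  ultimately have "(a, a * v) \<in> green_R" "(a * v, b) \<in> green_L"
    unfolding green_L_iff green_R_iff by blast+
  then show "(a, b) \<in> green_R O green_L" by blast
qed

lemma green_R_O_green_L_commute: "green_R O green_L = green_L O green_R"
proof -
  have "green_L\<inverse> = (green_L :: 'a rel)" "green_R\<inverse> = (green_R :: 'a rel)"
    by (auto simp: green_L_def green_R_def)
  then have "green_R O green_L = (green_L O green_R :: 'a rel)\<inverse>"
    "green_L O green_R = (green_R O green_L :: 'a rel)\<inverse>"
    by (simp_all add: converse_relcomp)
  then show ?thesis
    using green_L_O_green_R_subset by (metis converse_mono subset_antisym)
qed

lemma equiv_relcomp_commute:
  assumes r: "equiv UNIV r" and s: "equiv UNIV s" and comm: "r O s = s O r"
  shows "equiv UNIV (r O s)"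
proof (rule equivI)
  show "refl (r O s)"
    using r s by (fastforce simp: equiv_def refl_on_def)
  show "sym (r O s)"
    using r s comm by (simp add: equiv_def sym_conv_converse_eq converse_relcomp)
  have "(r O s) O (r O s) = (r O r) O (s O s)"
    by (metis O_assoc comm)
  also have "\<dots> \<subseteq> r O s"
    using r s by (meson equiv_def relcomp_mono trans_O_subset)
  finally show "trans (r O s)" unfolding trans_def by blast
qed simp

text \<open>As the two relations commute, their composite is itself an equivalence containing both,
  so it lies above the join. This supplies the element linking \<open>a\<close> to an
  idempotent.\<close>

lemma green_D_subset: "green_D \<subseteq> green_R O green_L"
proof -
  have "equiv UNIV (green_R O green_L :: 'a rel)"
    by (rule equiv_relcomp_commute[OF equiv_green_R equiv_green_L green_R_O_green_L_commute])
  moreover have "green_L \<subseteq> (green_R O green_L :: 'a rel)" "green_R \<subseteq> (green_R O green_L :: 'a rel)"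
    using equiv_green_R equiv_green_L by (fastforce simp: equiv_def refl_on_def)+
  ultimately show ?thesis unfolding green_D_def by blast
qed

lemma pseudo_inverse_idempotent_in_D_class:
  assumes "a = a * b * a"
  shows "a * b \<in> D_class a" and "(a * b) * (a * b) = a * b"
proof -
  have "(a, a * b) \<in> green_R"
    using assms by (auto simp: green_R_iff)
  then show "a * b \<in> D_class a" by (auto simp: D_class_def green_D_def)
  show "(a * b) * (a * b) = a * b" by (metis assms mult.assoc)
qed

lemma twist_of_class_le:
  assumes "twisting \<Phi>" and aba: "a = a * b * a"
  shows "twist_of_class \<Phi> (D_class a) \<le> \<Phi> a b + \<Phi> (a * b) a"
proof -
  note idem = pseudo_inverse_idempotent_in_D_class[OF aba]
  \<comment> \<open>This is the cocycle identity at the triple \<open>a * b\<close>,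
    \<open>a\<close>, \<open>b\<close>; as \<open>a * b * a = a\<close>, the terms
    \<open>\<Phi> a b\<close> cancel.\<close>
  have "\<Phi> (a * b) a + \<Phi> (a * b * a) b = \<Phi> (a * b) (a * b) + \<Phi> a b"
    using assms(1) unfolding twisting_def by blast
  then have "\<Phi> (a * b) a = \<Phi> (a * b) (a * b)" using aba by simp
  moreover have "twist_of_class \<Phi> (D_class a) \<le> \<Phi> (a * b) (a * b)"
    unfolding twist_of_class_def using idem by (blast intro: Least_le)
  ultimately show ?thesis by simp
qed

lemma ex_pseudo_inverse_twist_le:
  assumes tw: "twisting \<Phi>" and ti: "tight \<Phi>"
    and "e \<in> D_class a" and idem: "e * e = e"
  shows "\<exists>b. a = a * b * a \<and> \<Phi> a b + \<Phi> (a * b) a \<le> \<Phi> e e"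
proof -
  from \<open>e \<in> D_class a\<close> obtain c where "(a, c) \<in> green_R" "(c, e) \<in> green_L"
    using green_D_subset by (force simp: D_class_def)
  then obtain u' v' s' t' where "a = c * u'" "c = a * v'" "c = s' * e" "e = t' * c"
    unfolding green_L_iff green_R_iff by blast
  \<comment> \<open>Part (a) of tightness replaces the left multipliers \<open>s'\<close>,
    \<open>t'\<close>, and part (b) the right multipliers \<open>u'\<close>, \<open>v'\<close>,
    leaving the products unchanged.\<close>
  then obtain u v s t where
    u: "a = c * u" "\<Phi> c u = 0" and v: "c = a * v" "\<Phi> a v = 0" and
    s: "c = s * e" "\<Phi> s e = 0" and t: "e = t * c" "\<Phi> t c = 0"
    using ti unfolding tight_def by metis
  have cocycle: "\<Phi> x y + \<Phi> (x * y) z = \<Phi> x (y * z) + \<Phi> y z" for x y z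
    using tw unfolding twisting_def by blast
  have ce: "c * e = c" using s(1) idem by (metis mult.assoc)
  have avt: "a * (v * t) = c * t" using v(1) by (simp add: mult.assoc)
  have ctc: "c * t * c = c" using t(1) ce by (simp add: mult.assoc)
  \<comment> \<open>The witness is \<open>v * t\<close>: \<open>t\<close> is a pre-inverse of
    \<open>c\<close> because \<open>c * (t * c) = c * e = c\<close>, and \<open>v\<close> transports
    it to \<open>a\<close>.\<close>
  have "a * (v * t) * a = a"
    unfolding avt by (metis u(1) ctc mult.assoc)
  \<comment> \<open>The cocycle identity gives
    \<open>\<Phi> c t = \<Phi> a (v * t) + \<Phi> v t\<close>; this is the one place where an
    inequality enters.\<close>
  moreover have "\<Phi> a (v * t) \<le> \<Phi> c t"
    using cocycle[of a v t] v by simp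
  moreover have "\<Phi> (c * t) a = \<Phi> (c * t) c"
    using cocycle[of "c * t" c u] u ctc by simp
  moreover have "\<Phi> c t + \<Phi> (c * t) c = \<Phi> c e"
    using cocycle[of c t c] t by simp
  moreover have "\<Phi> c e = \<Phi> e e"
    using cocycle[of s e e] s idem by simp
  ultimately have "a = a * (v * t) * a \<and> \<Phi> a (v * t) + \<Phi> (a * (v * t)) a \<le> \<Phi> e e"
    by (simp add: avt)
  then show ?thesis by blast
qed

lemma Reg_iff: "a \<in> Reg f \<longleftrightarrow> (\<exists>x. a = f (f a x) a)"
  by (auto simp: Reg_def)

lemma Reg_twisted_mult_iff:
  "(i, a) \<in> Reg (twisted_mult \<Phi> q) \<longleftrightarrow>
     (\<exists>j b. i = i + j + i + nfold (\<Phi> a b + \<Phi> (a * b) a) q \<and> a = a * b * a)"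
proof -
  have "twisted_mult \<Phi> q (twisted_mult \<Phi> q (i, a) (j, b)) (i, a) =
      (i + j + i + nfold (\<Phi> a b + \<Phi> (a * b) a) q, a * b * a)" for j b
    by (simp add: twisted_mult_def nfold_add ac_simps)
  then show ?thesis
    by (simp only: Reg_iff split_paired_Ex prod.inject)
qed

theorem corollary7p3:
  fixes \<Phi> :: "'s::monoid_mult \<Rightarrow> 's \<Rightarrow> nat" and q :: "'m::comm_monoid_add"
  assumes "twisting \<Phi>" and "tight \<Phi>"
  shows "Reg (twisted_mult \<Phi> q) =
    {(i, a) \<in> Reg ((+) :: 'm \<Rightarrow> 'm \<Rightarrow> 'm) \<times> Reg ((*) :: 's \<Rightarrow> 's \<Rightarrow> 's).
       leJ i (nfold (twist_of_class \<Phi> (D_class a)) q)}"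
proof -
  have "(i, a) \<in> Reg (twisted_mult \<Phi> q) \<longleftrightarrow>
      i \<in> Reg (+) \<and> a \<in> Reg (*) \<and> leJ i (nfold (twist_of_class \<Phi> (D_class a)) q)" for i a
  proof
    assume "(i, a) \<in> Reg (twisted_mult \<Phi> q)"
    then obtain j b where a: "a = a * b * a"
      and i: "i = i + j + i + nfold (\<Phi> a b + \<Phi> (a * b) a) q"
      unfolding Reg_twisted_mult_iff by blast
    obtain d where d: "\<Phi> a b + \<Phi> (a * b) a = twist_of_class \<Phi> (D_class a) + d"
      using twist_of_class_le[OF assms(1) a] le_iff_add by blast
    have "i = i + (j + nfold (\<Phi> a b + \<Phi> (a * b) a) q) + i"
      using i by (simp add: ac_simps)
    moreover have "i = nfold (twist_of_class \<Phi> (D_class a)) q + (i + j + i + nfold d q)"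
      using i unfolding d nfold_add by (simp add: ac_simps)
    ultimately show "i \<in> Reg (+) \<and> a \<in> Reg (*) \<and>
        leJ i (nfold (twist_of_class \<Phi> (D_class a)) q)"
      unfolding Reg_iff leJ_def using a by blast
  next
    assume R: "i \<in> Reg (+) \<and> a \<in> Reg (*) \<and> leJ i (nfold (twist_of_class \<Phi> (D_class a)) q)"
    then obtain k b' l where k: "i = i + k + i" and b': "a = a * b' * a"
      and l: "i = nfold (twist_of_class \<Phi> (D_class a)) q + l"
      unfolding Reg_iff leJ_def by blast
    \<comment> \<open>The idempotent \<open>a * b'\<close> makes the set nonempty, so its least
      value is attained. The pre-inverse \<open>b'\<close> may have too large a twist and is
      replaced by one built from a minimizing \<open>e\<close>.\<close>
    have "\<exists>e. twist_of_class \<Phi> (D_class a) = \<Phi> e e \<and> e \<in> D_class a \<and> e * e = e"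
      using LeastI[of "\<lambda>n. n \<in> {\<Phi> e e | e. e \<in> D_class a \<and> e * e = e}"]
        pseudo_inverse_idempotent_in_D_class[OF b'] unfolding twist_of_class_def by blast
    then obtain b where b: "a = a * b * a"
      and "\<Phi> a b + \<Phi> (a * b) a \<le> twist_of_class \<Phi> (D_class a)"
      using ex_pseudo_inverse_twist_le[OF assms] by metis
    then obtain d where d: "twist_of_class \<Phi> (D_class a) = \<Phi> a b + \<Phi> (a * b) a + d"
      using le_iff_add by blast
    \<comment> \<open>Using \<open>k\<close> twice leaves a spare third copy of \<open>i\<close>.
      Expanding that copy by \<open>l\<close> produces the required multiple of \<open>q\<close>,
      and the surplus \<open>nfold d q + l\<close> joins \<open>k + k\<close> in the
      pre-inverse.\<close>
    have "i = i + k + (i + k + i)" using k by simp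
    also have "\<dots> = i + (k + k) + i + i" by (simp add: ac_simps)
    also have "\<dots> = i + (k + k) + i + (nfold (\<Phi> a b + \<Phi> (a * b) a) q + nfold d q + l)"
      using l unfolding d nfold_add by simp
    also have "\<dots> = i + (k + k + nfold d q + l) + i + nfold (\<Phi> a b + \<Phi> (a * b) a) q"
      by (simp add: ac_simps)
    finally show "(i, a) \<in> Reg (twisted_mult \<Phi> q)"
      unfolding Reg_twisted_mult_iff using b by blast
  qed
  then show ?thesis by auto
qed

end
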